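(* For every integer $n\ge 1$, the graph $L_n$ is vertex decomposable, but $\mathrm{Shed}(L_n)$ is not a dominating set of $L_n$.
   Context: For $n\ge1$, $L_n$ is the graph on the $8n+1$ vertices $X\cup Y\cup Z\cup\{w\}$ with $X=\{x_{i,1},x_{i,2}: 1\le i\le n\}$, $Y=\{y_{i,1},y_{i,2},y_{i,3}: 1\le i\le n\}$, $Z=\{z_{i,1},z_{i,2},z_{i,3}: 1\le i\le n\}$, whose edges are exactly: (i) for each $i$, the $5$-cycle edges $\{y_{i,1},y_{i,2}\},\{y_{i,2},y_{i,3}\},\{y_{i,3},x_{i,2}\},\{x_{i,2},x_{i,1}\},\{x_{i,1},y_{i,1}\}$; (ii) $\{z_{i,j},y_{i,j}\}$ for $1\le i\le n$, $j=1,2,3$; (iii) all pairs in $Z\cup\{w\}$ (a complete graph $K_{3n+1}$). For a graph $G=(V,E)$ and $x\in V$, $G\setminus x$ is the graph obtained by deleting $x$ and its incident edges; $N[x]$ is $x$ together with its neighbours, and $G\setminus N[x]$ is obtained by deleting all vertices of $N[x]$ and their incident edges. A graph is well-covered if all its maximal independent sets have the same cardinality. A graph $G$ is vertex decomposable if $G$ is well-covered and either (i) $G$ has no edges (possibly no vertices), or (ii) there is a vertex $x$ such that both $G\setminus x$ and $G\setminus N[x]$ are vertex decomposable. For a vertex decomposable graph $G$, $\mathrm{Shed}(G)$ is the set of vertices $x$ such that $G\setminus x$ and $G\setminus N[x]$ are both vertex decomposable. A set $D\subseteq V$ is dominating if every vertex of $V\setminus D$ is adjacent to a vertex of $D$.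 *)

theory Defs
  imports Main
begin

record 'a graph =
  verts :: "'a set"
  edges :: "'a set set"

text \<open>The notions below are meant for finite simple graphs only; in particular, they use
  \<^const>\<open>card\<close>, which is \<open>0\<close> on infinite sets.\<close>

definition finite_simple_graph :: "'a graph \<Rightarrow> bool" where
  "finite_simple_graph G \<longleftrightarrow>
     finite (verts G) \<and> (\<forall>e\<in>edges G. e \<subseteq> verts G \<and> card e = 2)"

definition del_verts :: "'a graph \<Rightarrow> 'a set \<Rightarrow> 'a graph" where
  "del_verts G S = \<lparr>verts = verts G - S, edges = {e \<in> edges G. e \<inter> S = {}}\<rparr>"

definition closed_nbhd :: "'a graph \<Rightarrow> 'a \<Rightarrow> 'a set" where
  "closed_nbhd G x = insert x {y \<in> verts G. {x, y} \<in> edges G}"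

definition independent_set :: "'a graph \<Rightarrow> 'a set \<Rightarrow> bool" where
  "independent_set G S \<longleftrightarrow> S \<subseteq> verts G \<and> (\<forall>u\<in>S. \<forall>v\<in>S. {u, v} \<notin> edges G)"

definition maximal_independent_set :: "'a graph \<Rightarrow> 'a set \<Rightarrow> bool" where
  "maximal_independent_set G S \<longleftrightarrow>
     independent_set G S \<and> (\<forall>T. independent_set G T \<and> S \<subseteq> T \<longrightarrow> T = S)"

definition well_covered :: "'a graph \<Rightarrow> bool" where
  "well_covered G \<longleftrightarrow>
     (\<forall>S T. maximal_independent_set G S \<and> maximal_independent_set G T \<longrightarrow> card S = card T)"

inductive vertex_decomposable :: "'a graph \<Rightarrow> bool" where
  edgeless: "well_covered G \<Longrightarrow> edges G = {} \<Longrightarrow> vertex_decomposable G"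
| shedding: "well_covered G \<Longrightarrow> x \<in> verts G \<Longrightarrow>
    vertex_decomposable (del_verts G {x}) \<Longrightarrow>
    vertex_decomposable (del_verts G (closed_nbhd G x)) \<Longrightarrow> vertex_decomposable G"

definition Shed :: "'a graph \<Rightarrow> 'a set" where
  "Shed G = {x \<in> verts G. vertex_decomposable (del_verts G {x}) \<and>
                           vertex_decomposable (del_verts G (closed_nbhd G x))}"

definition dominating_set :: "'a graph \<Rightarrow> 'a set \<Rightarrow> bool" where
  "dominating_set G D \<longleftrightarrow>
     D \<subseteq> verts G \<and> (\<forall>v \<in> verts G - D. \<exists>u\<in>D. {u, v} \<in> edges G)"

datatype L_vertex = X nat nat | Y nat nat | Z nat nat | W

definition L_clique :: "nat \<Rightarrow> L_vertex set" where
  "L_clique n = {Z i j |i j. i \<in> {1..n} \<and> j \<in> {1..3}} \<union> {W}"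

definition L_graph :: "nat \<Rightarrow> L_vertex graph" where
  "L_graph n =
    \<lparr>verts = {X i j |i j. i \<in> {1..n} \<and> j \<in> {1..2}}
           \<union> {Y i j |i j. i \<in> {1..n} \<and> j \<in> {1..3}}
           \<union> L_clique n,
     edges = (\<Union>i\<in>{1..n}. {{Y i 1, Y i 2}, {Y i 2, Y i 3}, {Y i 3, X i 2},
                             {X i 2, X i 1}, {X i 1, Y i 1}})
           \<union> {{Z i j, Y i j} |i j. i \<in> {1..n} \<and> j \<in> {1..3}}
           \<union> {{u, v} |u v. u \<in> L_clique n \<and> v \<in> L_clique n \<and> u \<noteq> v}\<rparr>"

lemma verts_L_graph_eq:
  "verts (L_graph n) = case_prod X ` ({1..n} \<times> {1..2}) \<union> case_prod Y ` ({1..n} \<times> {1..3})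
     \<union> case_prod Z ` ({1..n} \<times> {1..3}) \<union> {W}"
  by (auto simp: L_graph_def L_clique_def image_iff)

lemma finite_simple_graph_L_graph: "finite_simple_graph (L_graph n)"
proof -
  have "finite (verts (L_graph n))"
    by (simp add: verts_L_graph_eq)
  moreover have "e \<subseteq> verts (L_graph n) \<and> card e = 2" if "e \<in> edges (L_graph n)" for e
    using that by (auto simp: L_graph_def L_clique_def)
  ultimately show ?thesis
    by (simp add: finite_simple_graph_def)
qed

lemma card_verts_L_graph: "card (verts (L_graph n)) = 8 * n + 1"
proof -
  have "card (case_prod X ` ({1..n} \<times> {1..2::nat})) = 2 * n"
       "card (case_prod Y ` ({1..n} \<times> {1..3::nat})) = 3 * n"
       "card (case_prod Z ` ({1..n} \<times> {1..3::nat})) = 3 * n"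
    by (subst card_image; auto simp: inj_on_def)+
  then show ?thesis
    unfolding verts_L_graph_eq
    by (subst card_Un_disjoint; auto)+
qed

end

theory Submission
  imports Defs "HOL-Library.Disjoint_Sets"
begin

text \<open>The vertex \<open>w\<close> is simplicial, with closed neighbourhood the clique \<open>Z \<union> {w}\<close>. For every \<open>c\<close> in
  this clique, \<open>L\<^sub>n \<setminus> N[c]\<close> is a disjoint union of 5-cycles, at most one of which has lost a vertex,
  and so is vertex decomposable. As \<open>L\<^sub>n\<close> is well-covered, shedding the vertices of \<open>Z\<close> one after
  the other and finally \<open>w\<close> shows that \<open>L\<^sub>n\<close> is vertex decomposable.

  Deleting \<open>x\<^sub>1\<^sub>,\<^sub>1\<close> or one of its neighbours \<open>x\<^sub>1\<^sub>,\<^sub>2\<close>, \<open>y\<^sub>1\<^sub>,\<^sub>1\<close> turns a 5-cycle into a path on four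
  vertices; choosing the \<open>z\<^sub>1\<^sub>,\<^sub>j\<close> attached to a suitable end of it leaves a path on three vertices, which
  is not well-covered. So \<open>x\<^sub>1\<^sub>,\<^sub>1\<close> is neither a shedding vertex nor adjacent to one.\<close>

section \<open>Vertex deletion, maximal independent sets, well-coveredness\<close>

lemma edge_subset: "finite_simple_graph G \<Longrightarrow> e \<in> edges G \<Longrightarrow> e \<subseteq> verts G"
  by (auto simp: finite_simple_graph_def)

lemma no_loop: "finite_simple_graph G \<Longrightarrow> {v} \<notin> edges G"
  by (auto simp: finite_simple_graph_def)

lemma finite_simple_graph_del_verts [simp]:
  "finite_simple_graph G \<Longrightarrow> finite_simple_graph (del_verts G S)"
  by (auto simp: finite_simple_graph_def del_verts_def)

lemma verts_del_verts [simp]: "verts (del_verts G S) = verts G - S"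
  by (simp add: del_verts_def)

lemma edges_del_verts [simp]: "edges (del_verts G S) = {e \<in> edges G. e \<inter> S = {}}"
  by (simp add: del_verts_def)

lemma graph_eqI:
  fixes G H :: "'a graph"
  shows "verts G = verts H \<Longrightarrow> edges G = edges H \<Longrightarrow> G = H"
  by (cases G; cases H) simp

lemma del_verts_del_verts: "del_verts (del_verts G S) T = del_verts G (S \<union> T)"
  by (rule graph_eqI) auto

text \<open>Edges of a finite simple graph lie inside its vertex set, so a set that misses the
  vertices misses all edges too.\<close>

lemma del_verts_disjoint:
  assumes "finite_simple_graph G" "verts G \<inter> S = {}"
  shows "del_verts G S = G"
  using assms edge_subset[OF assms(1)] by (intro graph_eqI) (simp_all, blast+)

text \<open>A vertex outside \<open>S\<close> without a neighbour in \<open>S\<close> could be added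
  to \<open>S\<close>, so maximality amounts to domination. The absence of loops enters when
  \<open>v\<close> is added, because \<open>independent_set\<close> also tests
  \<open>{v, v}\<close>. This local form is what the computations with concrete graphs use.\<close>

lemma maximal_independent_set_iff:
  assumes "finite_simple_graph G"
  shows "maximal_independent_set G S \<longleftrightarrow>
    independent_set G S \<and> (\<forall>v\<in>verts G - S. \<exists>u\<in>S. {u, v} \<in> edges G)"
proof
  assume *: "maximal_independent_set G S"
  have "\<exists>u\<in>S. {u, v} \<in> edges G" if v: "v \<in> verts G - S" for v
  proof (rule ccontr)
    assume "\<not> ?thesis"
    then have "independent_set G (insert v S)"
      using * v no_loop[OF assms, of v]
      by (auto simp: maximal_independent_set_def independent_set_def insert_commute)
    then show False using * v by (auto simp: maximal_independent_set_def)
  qed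
  then show "independent_set G S \<and> (\<forall>v\<in>verts G - S. \<exists>u\<in>S. {u, v} \<in> edges G)"
    using * by (auto simp: maximal_independent_set_def)
next
  assume "independent_set G S \<and> (\<forall>v\<in>verts G - S. \<exists>u\<in>S. {u, v} \<in> edges G)"
  then show "maximal_independent_set G S"
    unfolding maximal_independent_set_def independent_set_def by blast
qed

lemma well_coveredI:
  assumes "\<And>S. maximal_independent_set G S \<Longrightarrow> card S = k"
  shows "well_covered G"
  using assms by (auto simp: well_covered_def)

text \<open>The common part \<open>R\<close> contributes equally to both cardinalities. Below,
  \<open>A\<close> and \<open>B\<close> live in the smallest graph \<open>L_graph 1\<close>, and
  \<open>R\<close> is a fixed choice of vertices in the remaining 5-cycles.\<close>

lemma not_well_coveredI:
  assumes "maximal_independent_set G (A \<union> R)" "maximal_independent_set G (B \<union> R)"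
    and "finite A" "finite B" "finite R" "A \<inter> R = {}" "B \<inter> R = {}" "card A \<noteq> card B"
  shows "\<not> well_covered G"
proof
  assume "well_covered G"
  then have "card (A \<union> R) = card (B \<union> R)" using assms(1,2) unfolding well_covered_def by blast
  then show False using assms(3-8) by (simp add: card_Un_disjoint)
qed

lemma vertex_decomposable_imp_well_covered: "vertex_decomposable G \<Longrightarrow> well_covered G"
  by (auto elim: vertex_decomposable.cases)

text \<open>Without edges the whole vertex set is the only maximal independent set, which gives
  well-coveredness.\<close>

lemma vertex_decomposable_edgeless:
  assumes "edges G = {}"
  shows "vertex_decomposable G"
proof (rule edgeless[OF _ assms])
  show "well_covered G"
    using assms
    by (intro well_coveredI[where k = "card (verts G)"])
      (auto simp: maximal_independent_set_def independent_set_def)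
qed

subsection \<open>Disjoint unions\<close>

definition graph_union :: "'a graph \<Rightarrow> 'a graph \<Rightarrow> 'a graph" where
  "graph_union G H = \<lparr>verts = verts G \<union> verts H, edges = edges G \<union> edges H\<rparr>"

lemma verts_graph_union [simp]: "verts (graph_union G H) = verts G \<union> verts H"
  by (simp add: graph_union_def)

lemma edges_graph_union [simp]: "edges (graph_union G H) = edges G \<union> edges H"
  by (simp add: graph_union_def)

lemma graph_union_commute: "graph_union G H = graph_union H G"
  by (auto simp: graph_union_def)

lemma finite_simple_graph_union:
  "finite_simple_graph G \<Longrightarrow> finite_simple_graph H \<Longrightarrow> finite_simple_graph (graph_union G H)"
  by (auto simp: finite_simple_graph_def)

text \<open>A vertex of \<open>G\<close> can only be dominated along an edge of \<open>G\<close>,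
  because edges of \<open>H\<close> stay inside the disjoint set \<open>verts H\<close>.\<close>

lemma maximal_independent_set_graph_union:
  assumes "finite_simple_graph G" "finite_simple_graph H" "verts G \<inter> verts H = {}"
    and "maximal_independent_set (graph_union G H) S"
  shows "maximal_independent_set G (S \<inter> verts G)"
proof -
  have S: "independent_set (graph_union G H) S"
    and dom: "\<forall>v\<in>verts (graph_union G H) - S. \<exists>u\<in>S. {u, v} \<in> edges (graph_union G H)"
    using assms(4)
    unfolding maximal_independent_set_iff[OF finite_simple_graph_union[OF assms(1,2)]] by auto
  have "\<exists>u\<in>S \<inter> verts G. {u, v} \<in> edges G" if v: "v \<in> verts G - S \<inter> verts G" for v
  proof -
    obtain u where u: "u \<in> S" "{u, v} \<in> edges G \<union> edges H"
      using dom v by auto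
    moreover have "{u, v} \<notin> edges H"
      using v assms(3) edge_subset[OF assms(2), of "{u, v}"] by auto
    ultimately show ?thesis
      using edge_subset[OF assms(1), of "{u, v}"] by auto
  qed
  then show ?thesis
    using S by (auto simp: maximal_independent_set_iff[OF assms(1)] independent_set_def)
qed

text \<open>A maximal independent set of the union splits into one of \<open>G\<close> and one of
  \<open>H\<close>; both parts have constant size, and the sizes add up.\<close>

lemma well_covered_graph_union:
  assumes G: "finite_simple_graph G" and H: "finite_simple_graph H"
    and disj: "verts G \<inter> verts H = {}"
    and "well_covered G" "well_covered H"
  shows "well_covered (graph_union G H)"
  unfolding well_covered_def
proof (intro allI impI, elim conjE)
  fix S T
  assume S: "maximal_independent_set (graph_union G H) S"
    and T: "maximal_independent_set (graph_union G H) T"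
  have card: "card R = card (R \<inter> verts G) + card (R \<inter> verts H)"
    if "maximal_independent_set (graph_union G H) R" for R
  proof -
    have "R = (R \<inter> verts G) \<union> (R \<inter> verts H)"
      using that by (auto simp: maximal_independent_set_def independent_set_def)
    moreover have "finite (R \<inter> verts G)" "finite (R \<inter> verts H)"
      using G H by (auto simp: finite_simple_graph_def)
    ultimately show ?thesis
      using disj card_Un_disjoint[of "R \<inter> verts G" "R \<inter> verts H"] by auto
  qed
  have "card (S \<inter> verts G) = card (T \<inter> verts G)"
    using maximal_independent_set_graph_union[OF G H disj] S T \<open>well_covered G\<close>
    by (auto simp: well_covered_def)
  moreover have "card (S \<inter> verts H) = card (T \<inter> verts H)"
    using maximal_independent_set_graph_union[OF H G] disj S T \<open>well_covered H\<close>
    by (auto simp: well_covered_def graph_union_commute[of H G] Int_commute)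
  ultimately show "card S = card T"
    using card[OF S] card[OF T] by simp
qed

text \<open>Neither deleting \<open>x\<close> nor deleting its closed neighbourhood touches
  \<open>H\<close>, so a shedding step in \<open>G\<close> is also one in the union.\<close>

lemma vertex_decomposable_graph_union_shedding:
  assumes G: "finite_simple_graph G" and H: "finite_simple_graph H"
    and disj: "verts G \<inter> verts H = {}"
    and wc: "well_covered G" "well_covered H" and x: "x \<in> verts G"
    and del: "vertex_decomposable (graph_union (del_verts G {x}) H)"
    and link: "vertex_decomposable (graph_union (del_verts G (closed_nbhd G x)) H)"
  shows "vertex_decomposable (graph_union G H)"
proof (rule shedding[of _ x])
  show "well_covered (graph_union G H)"
    using G H disj wc by (rule well_covered_graph_union)
  show "x \<in> verts (graph_union G H)"
    using x by simp
  have del_union: "del_verts (graph_union G H) S = graph_union (del_verts G S) H"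
    if "S \<subseteq> verts G" for S
  proof -
    have "verts H \<inter> S = {}" using that disj by blast
    then have "del_verts H S = H" by (rule del_verts_disjoint[OF H])
    then have "graph_union (del_verts G S) H = graph_union (del_verts G S) (del_verts H S)"
      by simp
    then show ?thesis by (auto simp: graph_union_def del_verts_def)
  qed
  show "vertex_decomposable (del_verts (graph_union G H) {x})"
    using del x by (simp add: del_union)
  have "{x, y} \<notin> edges H" for y
    using edge_subset[OF H] x disj by blast
  then have "closed_nbhd (graph_union G H) x = closed_nbhd G x"
    using edge_subset[OF G] by (auto simp: closed_nbhd_def)
  moreover have "closed_nbhd G x \<subseteq> verts G"
    using x by (auto simp: closed_nbhd_def)
  ultimately show "vertex_decomposable (del_verts (graph_union G H) (closed_nbhd (graph_union G H) x))"
    using link by (simp add: del_union)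
qed

text \<open>The shedding steps of \<open>G\<close> are carried out first, by induction on its
  decomposition. Once \<open>G\<close> has no edges left, a second induction carries out those of
  \<open>H\<close>.\<close>

lemma vertex_decomposable_graph_union:
  assumes "vertex_decomposable G" "vertex_decomposable H"
    and "finite_simple_graph G" "finite_simple_graph H" "verts G \<inter> verts H = {}"
  shows "vertex_decomposable (graph_union G H)"
  using assms(1,3,5)
proof (induction G rule: vertex_decomposable.induct)
  case (edgeless G)
  show ?case
    using assms(2,4) edgeless.prems(2)
  proof (induction H rule: vertex_decomposable.induct)
    case (edgeless H)
    then show ?case
      using \<open>edges G = {}\<close> by (intro vertex_decomposable_edgeless) simp
  next
    case (shedding H x)
    \<comment> \<open>The auxiliary lemma sheds a vertex of the first graph, hence \<open>H\<close>
      is moved to the front by commutativity.\<close>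
    have "vertex_decomposable (graph_union (del_verts H {x}) G)"
      using shedding.IH(1) shedding.prems by (subst graph_union_commute) auto
    moreover have "vertex_decomposable (graph_union (del_verts H (closed_nbhd H x)) G)"
      using shedding.IH(2) shedding.prems by (subst graph_union_commute) auto
    ultimately show ?case
      using shedding edgeless
      by (subst graph_union_commute) (rule vertex_decomposable_graph_union_shedding; auto)
  qed
next
  case (shedding G x)
  have "vertex_decomposable (graph_union (del_verts G {x}) H)"
    "vertex_decomposable (graph_union (del_verts G (closed_nbhd G x)) H)"
    using shedding.IH shedding.prems by auto
  then show ?case
    using shedding assms vertex_decomposable_imp_well_covered
    by (intro vertex_decomposable_graph_union_shedding[of G H x]) auto
qed

definition graph_Union :: "'i set \<Rightarrow> ('i \<Rightarrow> 'a graph) \<Rightarrow> 'a graph" where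
  "graph_Union I F = \<lparr>verts = (\<Union>i\<in>I. verts (F i)), edges = (\<Union>i\<in>I. edges (F i))\<rparr>"

lemma verts_graph_Union [simp]: "verts (graph_Union I F) = (\<Union>i\<in>I. verts (F i))"
  by (simp add: graph_Union_def)

lemma edges_graph_Union [simp]: "edges (graph_Union I F) = (\<Union>i\<in>I. edges (F i))"
  by (simp add: graph_Union_def)

lemma vertex_decomposable_graph_Union:
  assumes "finite I"
    and "\<And>i. i \<in> I \<Longrightarrow> finite_simple_graph (F i)"
    and "\<And>i. i \<in> I \<Longrightarrow> vertex_decomposable (F i)"
    and "disjoint_family_on (\<lambda>i. verts (F i)) I"
  shows "vertex_decomposable (graph_Union I F)"
  using assms
proof (induction I rule: finite_induct)
  case empty
  show ?case by (rule vertex_decomposable_edgeless) simp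
next
  case (insert i I)
  have "graph_Union (insert i I) F = graph_union (F i) (graph_Union I F)"
    by (simp add: graph_Union_def graph_union_def)
  moreover have "vertex_decomposable (graph_Union I F)"
    using insert by (intro insert.IH) (auto simp: disjoint_family_on_def)
  moreover have "finite_simple_graph (graph_Union I F)"
    using insert.hyps insert.prems(1) by (auto simp: finite_simple_graph_def)
  moreover have "verts (F i) \<inter> verts (graph_Union I F) = {}"
    using insert.hyps insert.prems(3) by (auto simp: disjoint_family_on_def)
  ultimately show ?case
    using insert.prems(1,2) by (simp only: vertex_decomposable_graph_union insertI1)
qed

subsection \<open>Simplicial vertices\<close>

definition simplicial_vertex :: "'a graph \<Rightarrow> 'a \<Rightarrow> bool" where
  "simplicial_vertex G w \<longleftrightarrow> w \<in> verts G \<and>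
     (\<forall>u\<in>closed_nbhd G w. \<forall>v\<in>closed_nbhd G w. u \<noteq> v \<longrightarrow> {u, v} \<in> edges G)"

text \<open>A maximal independent set of \<open>G \<setminus> c\<close> meets the clique \<open>N[w] \<setminus> {c}\<close>, hence it
  dominates \<open>c\<close> and is already maximal in \<open>G\<close>.\<close>

lemma well_covered_del_neighbour_of_simplicial:
  assumes G: "finite_simple_graph G" and "well_covered G" and w: "simplicial_vertex G w"
    and c: "c \<in> closed_nbhd G w" "c \<noteq> w"
  shows "well_covered (del_verts G {c})"
proof -
  have "maximal_independent_set G S" if "maximal_independent_set (del_verts G {c}) S" for S
  proof -
    have S: "S \<subseteq> verts G - {c}" and ind: "\<forall>u\<in>S. \<forall>v\<in>S. {u, v} \<notin> edges G"
      and dom: "\<forall>v\<in>verts G - {c} - S. \<exists>u\<in>S. {u, v} \<in> edges G"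
      using that unfolding maximal_independent_set_iff[OF finite_simple_graph_del_verts[OF G]]
        independent_set_def by auto
    have "\<exists>u\<in>S. {u, c} \<in> edges G"
    proof (cases "w \<in> S")
      case True
      then show ?thesis using c by (auto simp: closed_nbhd_def)
    next
      case False
      then have "w \<in> verts G - {c} - S" using w c by (auto simp: simplicial_vertex_def)
      then obtain u where u: "u \<in> S" "{u, w} \<in> edges G" using dom by blast
      then have "u \<in> closed_nbhd G w" "u \<noteq> c"
        using S by (auto simp: closed_nbhd_def insert_commute)
      then show ?thesis using u w c by (auto simp: simplicial_vertex_def)
    qed
    then show ?thesis
      using S ind dom unfolding maximal_independent_set_iff[OF G] independent_set_def by blast
  qed
  then show ?thesis
    using \<open>well_covered G\<close> unfolding well_covered_def by blast
qed

text \<open>The other vertices of the clique \<open>closed_nbhd G w\<close> are shed one by one, by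
  induction on the number of vertices. Each deletion keeps the graph well-covered and
  \<open>w\<close> simplicial, and it does not change the graphs left after deleting the closed
  neighbourhoods of the remaining clique vertices. The last vertex to be shed is
  \<open>w\<close>.\<close>

lemma vertex_decomposable_simplicial:
  assumes "finite_simple_graph G" "well_covered G" "simplicial_vertex G w"
    and "\<And>c. c \<in> closed_nbhd G w \<Longrightarrow> vertex_decomposable (del_verts G (closed_nbhd G c))"
  shows "vertex_decomposable G"
  using assms
proof (induction "card (verts G)" arbitrary: G rule: less_induct)
  case less
  note G = less.prems(1) and w = less.prems(3)
  have wG: "w \<in> verts G" "w \<in> closed_nbhd G w"
    using w by (auto simp: simplicial_vertex_def closed_nbhd_def)
  show ?case
  proof (cases "closed_nbhd G w = {w}")
    \<comment> \<open>Now \<open>w\<close> is isolated, so deleting \<open>w\<close> and deleting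
      its closed neighbourhood give the same graph.\<close>
    case True
    then show ?thesis
      using less.prems(4)[OF wG(2)] less.prems(2) wG by (intro shedding[of G w]) auto
  next
    case False
    then obtain c where c: "c \<in> closed_nbhd G w" "c \<noteq> w" using wG by blast
    then have cG: "c \<in> verts G" by (auto simp: closed_nbhd_def)
    let ?H = "del_verts G {c}"
    have nb: "closed_nbhd ?H v = closed_nbhd G v - {c}" if "v \<noteq> c" for v
      using that by (auto simp: closed_nbhd_def)
    have "vertex_decomposable ?H"
    proof (rule less.hyps)
      show "card (verts ?H) < card (verts G)"
        using G cG card_Diff1_less[of "verts G" c] by (simp add: finite_simple_graph_def)
      show "finite_simple_graph ?H" using G by simp
      show "well_covered ?H"
        using less.prems(1-3) c by (rule well_covered_del_neighbour_of_simplicial)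
      show "simplicial_vertex ?H w"
        using w c nb[of w] by (auto simp: simplicial_vertex_def)
      fix v assume "v \<in> closed_nbhd ?H w"
      then have v: "v \<in> closed_nbhd G w" "v \<noteq> c" using c nb[of w] by auto
      \<comment> \<open>Both \<open>v\<close> and \<open>c\<close> lie in the clique, so
        \<open>c\<close> disappears with the closed neighbourhood of \<open>v\<close> anyway, and
        deleting it beforehand makes no difference.\<close>
      then have "c \<in> closed_nbhd G v"
        using w c cG by (auto simp: simplicial_vertex_def closed_nbhd_def)
      then have "{c} \<union> closed_nbhd ?H v = closed_nbhd G v"
        using nb v by auto
      then show "vertex_decomposable (del_verts ?H (closed_nbhd ?H v))"
        using less.prems(4)[OF v(1)] by (simp only: del_verts_del_verts)
    qed
    then show ?thesis
      using less.prems(2) less.prems(4)[OF c(1)] cG by (intro shedding[of G c])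
  qed
qed

subsection \<open>Short paths and the 5-cycle\<close>

definition edge_graph :: "'a \<Rightarrow> 'a \<Rightarrow> 'a graph" where
  "edge_graph a b = \<lparr>verts = {a, b}, edges = {{a, b}}\<rparr>"

definition path4 :: "'a \<Rightarrow> 'a \<Rightarrow> 'a \<Rightarrow> 'a \<Rightarrow> 'a graph" where
  "path4 a b c d = \<lparr>verts = {a, b, c, d}, edges = {{a, b}, {b, c}, {c, d}}\<rparr>"

definition cycle5 :: "'a \<Rightarrow> 'a \<Rightarrow> 'a \<Rightarrow> 'a \<Rightarrow> 'a \<Rightarrow> 'a graph" where
  "cycle5 a b c d e =
    \<lparr>verts = {a, b, c, d, e}, edges = {{a, b}, {b, c}, {c, d}, {d, e}, {e, a}}\<rparr>"

text \<open>Both ends have the whole graph as closed neighbourhood, so the criterion for simplicial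
  vertices only asks about the empty graph.\<close>

lemma vertex_decomposable_edge_graph:
  assumes "a \<noteq> b"
  shows "vertex_decomposable (edge_graph a b)"
proof (rule vertex_decomposable_simplicial[where w = a])
  show G: "finite_simple_graph (edge_graph a b)"
    using assms by (auto simp: finite_simple_graph_def edge_graph_def)
  show "well_covered (edge_graph a b)"
  proof (rule well_coveredI)
    fix S assume "maximal_independent_set (edge_graph a b) S"
    then have "S \<subseteq> {a, b}" "\<not> (a \<in> S \<and> b \<in> S)" "a \<in> S \<or> b \<in> S"
      using assms unfolding maximal_independent_set_iff[OF G] independent_set_def
      by (auto simp: edge_graph_def doubleton_eq_iff)
    then have "S = {a} \<or> S = {b}" by blast
    then show "card S = 1" by auto
  qed
  show "simplicial_vertex (edge_graph a b) a"
    by (auto simp: simplicial_vertex_def closed_nbhd_def edge_graph_def insert_commute doubleton_eq_iff)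
  fix c assume "c \<in> closed_nbhd (edge_graph a b) a"
  then show "vertex_decomposable (del_verts (edge_graph a b) (closed_nbhd (edge_graph a b) c))"
    by (intro vertex_decomposable_edgeless) (auto simp: closed_nbhd_def edge_graph_def)
qed

text \<open>The end \<open>a\<close> is simplicial. Deleting the closed neighbourhood of
  \<open>a\<close> leaves the edge \<open>{c, d}\<close>, deleting that of \<open>b\<close> leaves
  the single vertex \<open>d\<close>.\<close>

lemma vertex_decomposable_path4:
  assumes "distinct [a, b, c, d]"
  shows "vertex_decomposable (path4 a b c d)"
proof (rule vertex_decomposable_simplicial[where w = a])
  let ?G = "path4 a b c d"
  show G: "finite_simple_graph ?G"
    using assms by (auto simp: finite_simple_graph_def path4_def)
  show "well_covered ?G"
  proof (rule well_coveredI)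
    fix S assume "maximal_independent_set ?G S"
    then have S: "S \<subseteq> verts ?G" and ind: "\<And>u v. {u, v} \<in> edges ?G \<Longrightarrow> \<not> (u \<in> S \<and> v \<in> S)"
      and dom: "\<And>v. v \<in> verts ?G \<Longrightarrow> v \<in> S \<or> (\<exists>u\<in>S. {u, v} \<in> edges ?G)"
      unfolding maximal_independent_set_iff[OF G] independent_set_def by blast+
    have "S \<subseteq> {a, b, c, d}"
      using S by (simp add: path4_def)
    moreover have "\<not> (a \<in> S \<and> b \<in> S)" "\<not> (b \<in> S \<and> c \<in> S)" "\<not> (c \<in> S \<and> d \<in> S)"
      by (rule ind, simp add: path4_def)+
    moreover have "a \<in> S \<or> b \<in> S"
      using dom[of a] assms by (auto simp: path4_def doubleton_eq_iff)
    moreover have "a \<in> S \<or> b \<in> S \<or> c \<in> S"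
      using dom[of b] assms by (auto simp: path4_def doubleton_eq_iff)
    moreover have "b \<in> S \<or> c \<in> S \<or> d \<in> S"
      using dom[of c] assms by (auto simp: path4_def doubleton_eq_iff)
    moreover have "c \<in> S \<or> d \<in> S"
      using dom[of d] assms by (auto simp: path4_def doubleton_eq_iff)
    ultimately have "S = {a, c} \<or> S = {a, d} \<or> S = {b, d}" by blast
    then show "card S = 2" using assms by (elim disjE) simp_all
  qed
  have Na: "closed_nbhd ?G a = {a, b}" and Nb: "closed_nbhd ?G b = {a, b, c}"
    using assms by (auto simp: closed_nbhd_def path4_def doubleton_eq_iff)
  show "simplicial_vertex ?G a"
    unfolding simplicial_vertex_def Na by (auto simp: path4_def insert_commute)
  fix v assume "v \<in> closed_nbhd ?G a"
  then consider "v = a" | "v = b" using Na by auto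
  then show "vertex_decomposable (del_verts ?G (closed_nbhd ?G v))"
  proof cases
    case 1
    have "del_verts ?G {a, b} = edge_graph c d"
      using assms by (intro graph_eqI) (auto simp: path4_def edge_graph_def)
    then show ?thesis using 1 Na assms by (simp add: vertex_decomposable_edge_graph)
  next
    case 2
    then show ?thesis
      using assms Nb by (intro vertex_decomposable_edgeless) (auto simp: path4_def)
  qed
qed

lemma finite_simple_graph_cycle5:
  "distinct [a, b, c, d, e] \<Longrightarrow> finite_simple_graph (cycle5 a b c d e)"
  by (auto simp: finite_simple_graph_def cycle5_def)

text \<open>Serves to move any vertex of the cycle to the front, where the deletion lemma below
  expects it.\<close>

lemma cycle5_rotate: "cycle5 a b c d e = cycle5 b c d e a"
  by (simp only: cycle5_def insert_commute)

lemma vertex_decomposable_cycle5_del: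
  assumes "distinct [a, b, c, d, e]"
  shows "vertex_decomposable (del_verts (cycle5 a b c d e) {a})"
proof -
  have "del_verts (cycle5 a b c d e) {a} = path4 b c d e"
    using assms by (intro graph_eqI) (auto simp: path4_def cycle5_def)
  then show ?thesis using assms by (simp add: vertex_decomposable_path4)
qed

text \<open>The maximal independent sets are the five pairs of non-adjacent vertices. Shedding
  \<open>a\<close> leaves a path on four vertices, and deleting its closed neighbourhood leaves an
  edge.\<close>

lemma vertex_decomposable_cycle5:
  assumes "distinct [a, b, c, d, e]"
  shows "vertex_decomposable (cycle5 a b c d e)"
proof (rule shedding[of _ a])
  let ?G = "cycle5 a b c d e"
  have G: "finite_simple_graph ?G" using assms by (rule finite_simple_graph_cycle5)
  show "well_covered ?G"
  proof (rule well_coveredI)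
    fix S assume "maximal_independent_set ?G S"
    then have S: "S \<subseteq> verts ?G" and ind: "\<And>u v. {u, v} \<in> edges ?G \<Longrightarrow> \<not> (u \<in> S \<and> v \<in> S)"
      and dom: "\<And>v. v \<in> verts ?G \<Longrightarrow> v \<in> S \<or> (\<exists>u\<in>S. {u, v} \<in> edges ?G)"
      unfolding maximal_independent_set_iff[OF G] independent_set_def by blast+
    have "\<not> (a \<in> S \<and> b \<in> S)" "\<not> (b \<in> S \<and> c \<in> S)" "\<not> (c \<in> S \<and> d \<in> S)"
      "\<not> (d \<in> S \<and> e \<in> S)" "\<not> (e \<in> S \<and> a \<in> S)"
      by (rule ind, simp add: cycle5_def)+
    moreover have "a \<in> S \<or> b \<in> S \<or> e \<in> S"
      using dom[of a] assms by (auto simp: cycle5_def doubleton_eq_iff)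
    moreover have "a \<in> S \<or> b \<in> S \<or> c \<in> S"
      using dom[of b] assms by (auto simp: cycle5_def doubleton_eq_iff)
    moreover have "b \<in> S \<or> c \<in> S \<or> d \<in> S"
      using dom[of c] assms by (auto simp: cycle5_def doubleton_eq_iff)
    moreover have "c \<in> S \<or> d \<in> S \<or> e \<in> S"
      using dom[of d] assms by (auto simp: cycle5_def doubleton_eq_iff)
    moreover have "a \<in> S \<or> d \<in> S \<or> e \<in> S"
      using dom[of e] assms by (auto simp: cycle5_def doubleton_eq_iff)
    ultimately have "S \<inter> {a, b, c, d, e} \<in> {{a, c}, {a, d}, {b, d}, {b, e}, {c, e}}"
      by (cases "a \<in> S"; cases "b \<in> S"; cases "c \<in> S"; simp; blast)
    then have "card (S \<inter> {a, b, c, d, e}) = 2"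
      using assms by (elim insertE emptyE) simp_all
    moreover have "S \<inter> {a, b, c, d, e} = S"
      using S by (auto simp: cycle5_def)
    ultimately show "card S = 2" by simp
  qed
  show "a \<in> verts ?G" by (simp add: cycle5_def)
  show "vertex_decomposable (del_verts ?G {a})"
    using assms by (rule vertex_decomposable_cycle5_del)
  have "closed_nbhd ?G a = {a, b, e}"
    using assms by (auto simp: closed_nbhd_def cycle5_def doubleton_eq_iff)
  then have "del_verts ?G (closed_nbhd ?G a) = edge_graph c d"
    using assms by (intro graph_eqI) (auto simp: cycle5_def edge_graph_def)
  then show "vertex_decomposable (del_verts ?G (closed_nbhd ?G a))"
    using assms by (simp add: vertex_decomposable_edge_graph)
qed

subsection \<open>The graph \<open>L\<^sub>n\<close>\<close>

text \<open>The vertices are listed in the order that reproduces the five edges in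
  \<open>L_graph\<close> literally.\<close>

definition L_cycle :: "nat \<Rightarrow> L_vertex graph" where
  "L_cycle i = cycle5 (Y i 1) (Y i 2) (Y i 3) (X i 2) (X i 1)"

lemma atLeast1_atMost3: "{1..3} = {1, 2, 3::nat}" and atLeast1_atMost2: "{1..2} = {1, 2::nat}"
  by auto

lemma verts_L_graph: "verts (L_graph n) = (\<Union>i\<in>{1..n}. verts (L_cycle i)) \<union> L_clique n"
  unfolding L_graph_def L_cycle_def cycle5_def atLeast1_atMost3 atLeast1_atMost2 by auto

lemma edges_L_graph: "edges (L_graph n) = (\<Union>i\<in>{1..n}. edges (L_cycle i))
    \<union> {{Z i j, Y i j} |i j. i \<in> {1..n} \<and> j \<in> {1..3}}
    \<union> {{u, v} |u v. u \<in> L_clique n \<and> v \<in> L_clique n \<and> u \<noteq> v}"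
  by (simp add: L_graph_def L_cycle_def cycle5_def)

lemma mem_L_clique [simp]:
  "W \<in> L_clique n" "X i j \<notin> L_clique n" "Y i j \<notin> L_clique n"
  "Z i j \<in> L_clique n \<longleftrightarrow> i \<in> {1..n} \<and> j \<in> {1..3}"
  by (auto simp: L_clique_def)

lemma L_graph_clique_edge:
  "u \<in> L_clique n \<Longrightarrow> v \<in> L_clique n \<Longrightarrow> u \<noteq> v \<Longrightarrow> {u, v} \<in> edges (L_graph n)"
  by (auto simp: edges_L_graph)

text \<open>In this and the following adjacency lemmas the unknown neighbour \<open>u\<close> comes
  first, as in the domination condition of \<open>maximal_independent_set_iff\<close>, so that the
  condition at a given vertex turns into a list of candidates.\<close>

lemma L_graph_adj_X1:
  "{u, X i 1} \<in> edges (L_graph n) \<longleftrightarrow> i \<in> {1..n} \<and> u \<in> {X i 2, Y i 1}"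
  by (auto simp: edges_L_graph L_cycle_def cycle5_def doubleton_eq_iff)

lemma L_graph_adj_X2:
  "{u, X i 2} \<in> edges (L_graph n) \<longleftrightarrow> i \<in> {1..n} \<and> u \<in> {X i 1, Y i 3}"
  by (auto simp: edges_L_graph L_cycle_def cycle5_def doubleton_eq_iff)

lemma L_graph_adj_Y1:
  "{u, Y i 1} \<in> edges (L_graph n) \<longleftrightarrow> i \<in> {1..n} \<and> u \<in> {Y i 2, X i 1, Z i 1}"
  by (auto simp: edges_L_graph L_cycle_def cycle5_def doubleton_eq_iff)

lemma L_graph_adj_Y2:
  "{u, Y i 2} \<in> edges (L_graph n) \<longleftrightarrow> i \<in> {1..n} \<and> u \<in> {Y i 1, Y i 3, Z i 2}"
  by (auto simp: edges_L_graph L_cycle_def cycle5_def doubleton_eq_iff)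

lemma L_graph_adj_Y3:
  "{u, Y i 3} \<in> edges (L_graph n) \<longleftrightarrow> i \<in> {1..n} \<and> u \<in> {Y i 2, X i 2, Z i 3}"
  by (auto simp: edges_L_graph L_cycle_def cycle5_def doubleton_eq_iff)

lemma L_graph_adj_Z:
  assumes "i \<in> {1..n}" "j \<in> {1..3}"
  shows "{u, Z i j} \<in> edges (L_graph n) \<longleftrightarrow> u = Y i j \<or> u \<in> L_clique n - {Z i j}"
proof
  show "u = Y i j \<or> u \<in> L_clique n - {Z i j}" if "{u, Z i j} \<in> edges (L_graph n)"
    using that by (auto simp: edges_L_graph L_cycle_def cycle5_def doubleton_eq_iff)
  show "{u, Z i j} \<in> edges (L_graph n)" if "u = Y i j \<or> u \<in> L_clique n - {Z i j}"
    using that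
  proof
    assume "u = Y i j"
    then show ?thesis using assms by (auto simp: edges_L_graph insert_commute)
  next
    assume "u \<in> L_clique n - {Z i j}"
    then show ?thesis using assms by (intro L_graph_clique_edge) auto
  qed
qed

lemma L_graph_adj_W: "{u, W} \<in> edges (L_graph n) \<longleftrightarrow> u \<in> L_clique n - {W}"
proof
  show "u \<in> L_clique n - {W}" if "{u, W} \<in> edges (L_graph n)"
    using that by (auto simp: edges_L_graph L_cycle_def cycle5_def doubleton_eq_iff)
  show "{u, W} \<in> edges (L_graph n)" if "u \<in> L_clique n - {W}"
    using that by (intro L_graph_clique_edge) auto
qed

lemmas L_graph_adj = L_graph_adj_X1 L_graph_adj_X2 L_graph_adj_Y1 L_graph_adj_Y2 L_graph_adj_Y3
  L_graph_adj_Z L_graph_adj_W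

lemma closed_nbhd_L_graph_W: "closed_nbhd (L_graph n) W = L_clique n"
proof -
  have "{W, u} \<in> edges (L_graph n) \<longleftrightarrow> u \<in> L_clique n - {W}" for u
    using L_graph_adj_W[of u n] by (simp only: insert_commute)
  moreover have "L_clique n \<subseteq> verts (L_graph n)" by (simp add: verts_L_graph)
  ultimately show ?thesis
    using mem_L_clique(1)[of n] unfolding closed_nbhd_def by blast
qed

lemma closed_nbhd_L_graph_Z:
  assumes "i \<in> {1..n}" "j \<in> {1..3}"
  shows "closed_nbhd (L_graph n) (Z i j) = insert (Y i j) (L_clique n)"
proof -
  have "{Z i j, u} \<in> edges (L_graph n) \<longleftrightarrow> u = Y i j \<or> u \<in> L_clique n - {Z i j}" for u
    using L_graph_adj_Z[OF assms, of u] by (simp only: insert_commute)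
  moreover have "L_clique n \<subseteq> verts (L_graph n)" by (simp add: verts_L_graph)
  moreover have "Y i j \<in> verts (L_graph n)" using assms by (simp add: L_graph_def)
  moreover have "Z i j \<in> L_clique n" using assms by simp
  ultimately show ?thesis
    unfolding closed_nbhd_def by blast
qed

section \<open>Well-coveredness of \<open>L_graph n\<close>\<close>

text \<open>Every maximal independent set has one vertex in the clique and two in each of the
  \<open>n\<close> 5-cycles, hence \<open>2 * n + 1\<close> vertices.\<close>

lemma well_covered_L_graph: "well_covered (L_graph n)"
proof (rule well_coveredI)
  fix S assume "maximal_independent_set (L_graph n) S"
  then have S: "S \<subseteq> verts (L_graph n)"
    and ind: "\<And>u v. {u, v} \<in> edges (L_graph n) \<Longrightarrow> \<not> (u \<in> S \<and> v \<in> S)"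
    and dom: "\<And>v. v \<in> verts (L_graph n) \<Longrightarrow> v \<in> S \<or> (\<exists>u\<in>S. {u, v} \<in> edges (L_graph n))"
    unfolding maximal_independent_set_iff[OF finite_simple_graph_L_graph] independent_set_def
    by blast+
  \<comment> \<open>All neighbours of \<open>W\<close> belong to the clique, so \<open>S\<close>
    needs a clique vertex to contain or dominate \<open>W\<close>.\<close>
  have "\<exists>c. c \<in> S \<inter> L_clique n"
    using dom[of W] L_graph_adj_W[of _ n] by (auto simp: verts_L_graph)
  then obtain c where c: "c \<in> S \<inter> L_clique n" ..
  have clique: "u = v" if "u \<in> S" "v \<in> S" "u \<in> L_clique n" "v \<in> L_clique n" for u v
    using that ind L_graph_clique_edge by blast
  have "S \<inter> L_clique n = {c}"
    using c clique by blast
  then have card_clique: "card (S \<inter> L_clique n) = 1" by simp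
  have card_cycle: "card (S \<inter> verts (L_cycle i)) = 2" if i: "i \<in> {1..n}" for i
  proof -
    let ?a = "Y i 1" and ?b = "Y i 2" and ?c = "Y i 3" and ?d = "X i 2" and ?e = "X i 1"
    have V: "verts (L_cycle i) = {?a, ?b, ?c, ?d, ?e}"
      by (auto simp: L_cycle_def cycle5_def)
    then have sub: "{?a, ?b, ?c, ?d, ?e} \<subseteq> verts (L_graph n)"
      using i verts_L_graph by blast
    have "\<not> (?a \<in> S \<and> ?b \<in> S)" "\<not> (?b \<in> S \<and> ?c \<in> S)" "\<not> (?d \<in> S \<and> ?c \<in> S)"
      "\<not> (?e \<in> S \<and> ?d \<in> S)" "\<not> (?e \<in> S \<and> ?a \<in> S)"
      using i by (intro ind; simp add: L_graph_adj del: One_nat_def)+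
    moreover have "?a \<in> S \<or> ?b \<in> S \<or> ?e \<in> S \<or> Z i 1 \<in> S"
      using dom[of ?a] sub unfolding L_graph_adj by blast
    moreover have "?b \<in> S \<or> ?a \<in> S \<or> ?c \<in> S \<or> Z i 2 \<in> S"
      using dom[of ?b] sub unfolding L_graph_adj by blast
    moreover have "?c \<in> S \<or> ?b \<in> S \<or> ?d \<in> S \<or> Z i 3 \<in> S"
      using dom[of ?c] sub unfolding L_graph_adj by blast
    moreover have "?d \<in> S \<or> ?e \<in> S \<or> ?c \<in> S"
      using dom[of ?d] sub unfolding L_graph_adj by blast
    moreover have "?e \<in> S \<or> ?d \<in> S \<or> ?a \<in> S"
      using dom[of ?e] sub unfolding L_graph_adj by blast
    \<comment> \<open>At most one vertex of the cycle is dominated from outside. If some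
      \<open>Z i j\<close> is in \<open>S\<close>, then \<open>Y i j\<close> is not, and
      \<open>S\<close> restricts to a maximal independent set of the remaining path on four
      vertices, again of size 2.\<close>
    moreover have "\<not> (Z i 1 \<in> S \<and> Z i 2 \<in> S)" "\<not> (Z i 1 \<in> S \<and> Z i 3 \<in> S)"
      "\<not> (Z i 2 \<in> S \<and> Z i 3 \<in> S)"
      using i clique[of "Z i 1" "Z i 2"] clique[of "Z i 1" "Z i 3"] clique[of "Z i 2" "Z i 3"]
      by auto
    moreover have "\<not> (Z i 1 \<in> S \<and> ?a \<in> S)" "\<not> (Z i 2 \<in> S \<and> ?b \<in> S)" "\<not> (Z i 3 \<in> S \<and> ?c \<in> S)"
      using i by (intro ind; simp add: L_graph_adj del: One_nat_def)+
    ultimately have "S \<inter> verts (L_cycle i) \<in> {{?a, ?c}, {?a, ?d}, {?b, ?d}, {?b, ?e}, {?c, ?e}}"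
      unfolding V by (cases "?a \<in> S"; cases "?b \<in> S"; cases "?c \<in> S"; simp; blast)
    then show ?thesis by (elim insertE emptyE) simp_all
  qed
  have fin: "finite (S \<inter> verts (L_cycle i))" for i
    by (auto simp: L_cycle_def cycle5_def)
  let ?U = "\<Union>i\<in>{1..n}. S \<inter> verts (L_cycle i)"
  have "card (?U \<union> (S \<inter> L_clique n)) = card ?U + card (S \<inter> L_clique n)"
  proof (rule card_Un_disjoint)
    show "finite ?U" by (intro finite_UN_I finite_atLeastAtMost fin)
    \<comment> \<open>Finiteness follows from the cardinality being 1, as \<open>card\<close> is 0
      on infinite sets.\<close>
    show "finite (S \<inter> L_clique n)" using card_clique by (intro card_ge_0_finite) simp
    show "?U \<inter> (S \<inter> L_clique n) = {}" by (auto simp: L_cycle_def cycle5_def)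
  qed
  moreover have "?U \<union> (S \<inter> L_clique n) = S"
    using S by (auto simp: verts_L_graph)
  ultimately have "card S = card ?U + card (S \<inter> L_clique n)" by simp
  also have "card ?U = (\<Sum>i\<in>{1..n}. card (S \<inter> verts (L_cycle i)))"
    using fin by (intro card_UN_disjoint) (auto simp: L_cycle_def cycle5_def)
  also have "\<dots> = 2 * n" using card_cycle by simp
  finally show "card S = 2 * n + 1" using card_clique by simp
qed

section \<open>Vertex decomposability of \<open>L_graph n\<close>\<close>

text \<open>The sets \<open>N\<close> have the shape of closed neighbourhoods of clique vertices.
  Such a set takes at most one vertex from the cycle, namely \<open>Y k j\<close> when
  \<open>k = i\<close>, and leaves a 5-cycle or a path on four vertices.\<close>

lemma vertex_decomposable_L_cycle_del:
  assumes "N = L_clique n \<or> (\<exists>k. \<exists>j\<in>{1..3}. N = insert (Y k j) (L_clique n))"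
  shows "vertex_decomposable (del_verts (L_cycle i) N)"
proof -
  have fsg: "finite_simple_graph (L_cycle i)"
    unfolding L_cycle_def by (rule finite_simple_graph_cycle5) simp
  have vd: "vertex_decomposable (L_cycle i)"
    unfolding L_cycle_def by (rule vertex_decomposable_cycle5) simp
  have disj: "verts (L_cycle i) \<inter> L_clique n = {}"
    by (auto simp: L_cycle_def cycle5_def)
  show ?thesis
  proof (cases "verts (L_cycle i) \<inter> N = {}")
    case True
    then show ?thesis using vd del_verts_disjoint[OF fsg] by simp
  next
    case False
    then obtain k j where kj: "j \<in> {1..3}" "N = insert (Y k j) (L_clique n)"
      using assms disj by blast
    then have "Y k j \<in> verts (L_cycle i)"
      using False disj by blast
    then have "k = i" by (auto simp: L_cycle_def cycle5_def)
    with kj have j: "j \<in> {1..3}" "N = insert (Y i j) (L_clique n)" by simp_all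
    have "del_verts (L_cycle i) N = del_verts (del_verts (L_cycle i) {Y i j}) (L_clique n)"
      unfolding j del_verts_del_verts by simp
    also have "\<dots> = del_verts (L_cycle i) {Y i j}"
      using disj fsg by (intro del_verts_disjoint) auto
    finally have eq: "del_verts (L_cycle i) N = del_verts (L_cycle i) {Y i j}" .
    \<comment> \<open>\<open>vertex_decomposable_cycle5_del\<close> removes the first vertex of the
      cycle, so \<open>Y i 2\<close> and \<open>Y i 3\<close> are rotated to the front.\<close>
    have rot: "L_cycle i = cycle5 (Y i 2) (Y i 3) (X i 2) (X i 1) (Y i 1)"
      "L_cycle i = cycle5 (Y i 3) (X i 2) (X i 1) (Y i 1) (Y i 2)"
      unfolding L_cycle_def by (metis cycle5_rotate)+
    consider "j = 1" | "j = 2" | "j = 3" using j(1) unfolding atLeast1_atMost3 by blast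
    then show ?thesis
    proof cases
      case 1
      then show ?thesis
        unfolding eq unfolding L_cycle_def
        using vertex_decomposable_cycle5_del[of "Y i 1" "Y i 2" "Y i 3" "X i 2" "X i 1"] by simp
    next
      case 2
      then show ?thesis
        unfolding eq unfolding rot(1)
        using vertex_decomposable_cycle5_del[of "Y i 2" "Y i 3" "X i 2" "X i 1" "Y i 1"] by simp
    next
      case 3
      then show ?thesis
        unfolding eq unfolding rot(2)
        using vertex_decomposable_cycle5_del[of "Y i 3" "X i 2" "X i 1" "Y i 1" "Y i 2"] by simp
    qed
  qed
qed

text \<open>Every edge outside the 5-cycles has an end in the clique and is therefore
  deleted.\<close>

lemma L_graph_del_clique:
  assumes "L_clique n \<subseteq> N"
  shows "del_verts (L_graph n) N = graph_Union {1..n} (\<lambda>i. del_verts (L_cycle i) N)"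
proof (rule graph_eqI)
  show "verts (del_verts (L_graph n) N) = verts (graph_Union {1..n} (\<lambda>i. del_verts (L_cycle i) N))"
    using assms by (auto simp: verts_L_graph)
  have "e \<inter> N \<noteq> {}" if "e \<in> edges (L_graph n)" "e \<notin> (\<Union>i\<in>{1..n}. edges (L_cycle i))" for e
  proof -
    have "e \<inter> L_clique n \<noteq> {}" using that unfolding edges_L_graph by auto
    then show ?thesis using assms by blast
  qed
  moreover have "(\<Union>i\<in>{1..n}. edges (L_cycle i)) \<subseteq> edges (L_graph n)"
    unfolding edges_L_graph by blast
  ultimately show "edges (del_verts (L_graph n) N) =
      edges (graph_Union {1..n} (\<lambda>i. del_verts (L_cycle i) N))"
    unfolding edges_graph_Union edges_del_verts by blast
qed

lemma vertex_decomposable_L_graph: "vertex_decomposable (L_graph n)"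
proof (rule vertex_decomposable_simplicial[where w = W])
  show "finite_simple_graph (L_graph n)" by (rule finite_simple_graph_L_graph)
  show "well_covered (L_graph n)" by (rule well_covered_L_graph)
  show "simplicial_vertex (L_graph n) W"
    unfolding simplicial_vertex_def closed_nbhd_L_graph_W
    using L_graph_clique_edge by (auto simp: verts_L_graph)
  fix c assume "c \<in> closed_nbhd (L_graph n) W"
  then have c: "c \<in> L_clique n" by (simp only: closed_nbhd_L_graph_W)
  let ?N = "closed_nbhd (L_graph n) c"
  \<comment> \<open>The first alternative arises from \<open>c = W\<close>, the second from
    \<open>c = Z k j\<close>.\<close>
  have N: "?N = L_clique n \<or> (\<exists>k. \<exists>j\<in>{1..3}. ?N = insert (Y k j) (L_clique n))"
    using c closed_nbhd_L_graph_W closed_nbhd_L_graph_Z unfolding L_clique_def by blast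
  then have "L_clique n \<subseteq> ?N" by auto
  then have "del_verts (L_graph n) ?N = graph_Union {1..n} (\<lambda>i. del_verts (L_cycle i) ?N)"
    by (rule L_graph_del_clique)
  moreover have "vertex_decomposable (graph_Union {1..n} (\<lambda>i. del_verts (L_cycle i) ?N))"
  proof (rule vertex_decomposable_graph_Union)
    fix i
    have "finite_simple_graph (L_cycle i)"
      unfolding L_cycle_def by (rule finite_simple_graph_cycle5) simp
    then show "finite_simple_graph (del_verts (L_cycle i) ?N)" by simp
    show "vertex_decomposable (del_verts (L_cycle i) ?N)"
      using N by (rule vertex_decomposable_L_cycle_del)
  next
    show "disjoint_family_on (\<lambda>i. verts (del_verts (L_cycle i) ?N)) {1..n}"
      by (auto simp: disjoint_family_on_def L_cycle_def cycle5_def)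
  qed simp
  ultimately show "vertex_decomposable (del_verts (L_graph n) ?N)" by simp
qed

section \<open>Vertices that are not shedding vertices\<close>

text \<open>A maximal independent set of the 5-cycles other than the first; it reduces the computations
  with \<open>L\<^sub>n\<close> to computations with \<open>L\<^sub>1\<close>.\<close>

definition L_tail :: "nat \<Rightarrow> L_vertex set" where
  "L_tail n = (\<Union>i\<in>{2..n}. {X i 1, Y i 2})"

lemma verts_L_graph_1:
  "verts (L_graph 1) = {X 1 1, X 1 2, Y 1 1, Y 1 2, Y 1 3, Z 1 1, Z 1 2, Z 1 3, W}"
  unfolding L_graph_def L_clique_def atLeast1_atMost3 atLeast1_atMost2 by auto

text \<open>Together the two claims say that \<open>L_graph 1\<close> is an induced subgraph of
  \<open>L_graph n\<close>.\<close>

lemma L_graph_mono: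
  assumes "n \<ge> 1"
  shows "verts (L_graph 1) \<subseteq> verts (L_graph n)"
    and "e \<subseteq> verts (L_graph 1) \<Longrightarrow> e \<in> edges (L_graph n) \<longleftrightarrow> e \<in> edges (L_graph 1)"
proof -
  show "verts (L_graph 1) \<subseteq> verts (L_graph n)"
    using assms by (auto simp: L_graph_def L_clique_def)
  assume e: "e \<subseteq> verts (L_graph 1)"
  have "{u, v} \<in> edges (L_graph n) \<longleftrightarrow> {u, v} \<in> edges (L_graph 1)"
    if v: "v \<in> verts (L_graph 1)" and u: "u \<in> verts (L_graph 1)" for u v
  proof -
    \<comment> \<open>The adjacency lemmas depend on \<open>n\<close> only through the range of the
      index and through the clique, and on vertices of \<open>L_graph 1\<close> the two cliques
      agree.\<close>
    have "u \<in> L_clique n \<longleftrightarrow> u \<in> L_clique 1"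
      using u assms unfolding verts_L_graph_1 by auto
    then show ?thesis
      using v assms unfolding verts_L_graph_1
      by (elim insertE emptyE) (simp_all add: L_graph_adj del: One_nat_def)
  qed
  \<comment> \<open>If \<open>e\<close> is an edge of neither graph, the equivalence is trivial;
    only an edge has to be written as a pair.\<close>
  moreover obtain u v where "e = {u, v}" if "e \<in> edges (L_graph n) \<or> e \<in> edges (L_graph 1)"
  proof (cases "e \<in> edges (L_graph n) \<or> e \<in> edges (L_graph 1)")
    case True
    then have "card e = 2"
      using finite_simple_graph_L_graph unfolding finite_simple_graph_def by blast
    then show ?thesis using that by (auto simp: card_2_iff)
  qed (use that in blast)
  ultimately show "e \<in> edges (L_graph n) \<longleftrightarrow> e \<in> edges (L_graph 1)"
    using e by blast
qed

text \<open>In a cycle with index \<open>i \<ge> 2\<close>, \<open>X i 1\<close> dominates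
  \<open>X i 2\<close> and \<open>Y i 1\<close>, while \<open>Y i 2\<close> dominates
  \<open>Y i 3\<close>. The vertices \<open>Z i j\<close> with \<open>i \<ge> 2\<close> are
  dominated by the clique vertex \<open>c\<close>, and \<open>A\<close> takes care of the
  rest.\<close>

lemma maximal_independent_set_L_graph_extend:
  assumes n: "n \<ge> 1" and x: "x \<in> verts (L_cycle 1)"
    and A: "maximal_independent_set (del_verts (L_graph 1) {x}) A"
    and c: "c \<in> A" "c \<in> L_clique 1"
  shows "maximal_independent_set (del_verts (L_graph n) {x}) (A \<union> L_tail n)"
proof -
  have sub: "A \<subseteq> verts (L_graph 1) - {x}"
    and ind: "\<And>u v. u \<in> A \<Longrightarrow> v \<in> A \<Longrightarrow> {u, v} \<notin> edges (L_graph 1)"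
    and dom: "\<And>v. v \<in> verts (L_graph 1) - {x} - A \<Longrightarrow> \<exists>u\<in>A. {u, v} \<in> edges (L_graph 1)"
    using A unfolding maximal_independent_set_iff[OF finite_simple_graph_del_verts[OF
        finite_simple_graph_L_graph]] independent_set_def by auto
  have tail: "{u, v} \<notin> edges (L_graph n)" if v: "v \<in> L_tail n" and u: "u \<in> A \<union> L_tail n" for u v
  proof -
    obtain i where i: "i \<ge> 2" "v = X i 1 \<or> v = Y i 2"
      using v by (auto simp: L_tail_def)
    \<comment> \<open>These are all the neighbours of \<open>X i 1\<close> and \<open>Y i 2\<close>.
      As \<open>i \<ge> 2\<close>, none lies in \<open>L_graph 1\<close>, and none was chosen for
      \<open>L_tail n\<close>.\<close>
    have "u \<notin> {X i 2, Y i 1, Y i 3, Z i 2}"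
    proof
      assume *: "u \<in> {X i 2, Y i 1, Y i 3, Z i 2}"
      then have "u \<notin> verts (L_graph 1)"
        using i(1) by (auto simp: L_graph_def L_clique_def)
      moreover have "u \<notin> L_tail n" using * by (auto simp: L_tail_def)
      ultimately show False using u sub by blast
    qed
    then show ?thesis
      using i(2) L_graph_adj_X1[of u i n] L_graph_adj_Y2[of u i n] by blast
  qed
  have indep: "{u, v} \<notin> edges (L_graph n)" if "u \<in> A \<union> L_tail n" "v \<in> A \<union> L_tail n" for u v
  proof (cases "u \<in> A \<and> v \<in> A")
    case True
    then have "{u, v} \<subseteq> verts (L_graph 1)" using sub by blast
    then show ?thesis using True ind L_graph_mono(2)[OF n] by blast
  next
    case False
    then show ?thesis using tail[of u v] tail[of v u] that by (auto simp: insert_commute)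
  qed
  have dominated: "\<exists>u\<in>A \<union> L_tail n. {u, v} \<in> edges (L_graph n)"
    if v: "v \<in> verts (L_graph n) - {x} - (A \<union> L_tail n)" for v
  proof (cases "v \<in> verts (L_graph 1)")
    case True
    then obtain u where u: "u \<in> A" "{u, v} \<in> edges (L_graph 1)" using dom v by blast
    then have "{u, v} \<subseteq> verts (L_graph 1)" using sub True by blast
    then show ?thesis using u L_graph_mono(2)[OF n] by blast
  next
    case False
    have cn: "c \<in> L_clique n" using c n by (auto simp: L_clique_def)
    from v consider "v \<in> L_clique n" | i where "i \<in> {1..n}" "v \<in> verts (L_cycle i)"
      by (auto simp: verts_L_graph)
    then show ?thesis
    proof cases
      \<comment> \<open>Here \<open>v\<close> is some \<open>Z i j\<close> with
        \<open>i \<ge> 2\<close>, adjacent to \<open>c\<close> inside the clique.\<close>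
      case 1
      moreover have "c \<noteq> v" using False c sub by auto
      ultimately show ?thesis using L_graph_clique_edge[OF cn] c by blast
    next
      case (2 i)
      have "i \<noteq> 1" using False 2 by (auto simp: verts_L_graph)
      then have i: "i \<in> {2..n}" using 2 by auto
      then have t: "X i 1 \<in> L_tail n" "Y i 2 \<in> L_tail n" by (auto simp: L_tail_def)
      then have "v \<in> {Y i 1, Y i 3, X i 2}"
        using 2 v by (auto simp: L_cycle_def cycle5_def)
      then show ?thesis
        using t L_graph_adj_Y1[of "X i 1" i n] L_graph_adj_Y3[of "Y i 2" i n]
          L_graph_adj_X2[of "X i 1" i n] 2(1) by blast
    qed
  qed
  have in_verts: "A \<union> L_tail n \<subseteq> verts (L_graph n) - {x}"
  proof -
    have "L_tail n \<subseteq> verts (L_graph n)" by (auto simp: L_tail_def L_graph_def)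
    moreover have "x \<notin> L_tail n" using x by (auto simp: L_tail_def L_cycle_def cycle5_def)
    ultimately show ?thesis using sub L_graph_mono(1)[OF n] by blast
  qed
  have "\<exists>u\<in>A \<union> L_tail n. {u, v} \<in> edges (del_verts (L_graph n) {x})"
    if v: "v \<in> verts (L_graph n) - {x} - (A \<union> L_tail n)" for v
  proof -
    obtain u where u: "u \<in> A \<union> L_tail n" "{u, v} \<in> edges (L_graph n)"
      using dominated[OF v] by blast
    moreover have "{u, v} \<inter> {x} = {}" using u v in_verts by blast
    ultimately show ?thesis by auto
  qed
  moreover have "{u, v} \<notin> edges (del_verts (L_graph n) {x})"
    if "u \<in> A \<union> L_tail n" "v \<in> A \<union> L_tail n" for u v
    using indep[OF that] by simp
  ultimately show ?thesis
    using in_verts unfolding maximal_independent_set_iff[OF finite_simple_graph_del_verts[OF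
        finite_simple_graph_L_graph]] independent_set_def verts_del_verts by blast
qed

text \<open>Adding \<open>L_tail n\<close> to both \<open>A\<close> and \<open>B\<close> preserves
  the difference in size, so well-coveredness already fails.\<close>

lemma not_vertex_decomposable_L_graph_del:
  assumes n: "n \<ge> 1" and x: "x \<in> verts (L_cycle 1)"
    and A: "maximal_independent_set (del_verts (L_graph 1) {x}) A" "A \<inter> L_clique 1 \<noteq> {}"
    and B: "maximal_independent_set (del_verts (L_graph 1) {x}) B" "B \<inter> L_clique 1 \<noteq> {}"
    and "card A \<noteq> card B"
  shows "\<not> vertex_decomposable (del_verts (L_graph n) {x})"
proof -
  have *: "finite S" "S \<inter> L_tail n = {}"
    if "maximal_independent_set (del_verts (L_graph 1) {x}) S" for S
  proof -
    have S: "S \<subseteq> verts (L_graph 1)"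
      using that by (auto simp: maximal_independent_set_def independent_set_def)
    then show "finite S"
      using finite_simple_graph_L_graph finite_subset unfolding finite_simple_graph_def by blast
    show "S \<inter> L_tail n = {}"
      using S by (auto simp: L_tail_def L_graph_def)
  qed
  have "\<not> well_covered (del_verts (L_graph n) {x})"
    using assms(7) A B * maximal_independent_set_L_graph_extend[OF n x]
    by (intro not_well_coveredI[of _ A "L_tail n" B]) (auto simp: L_tail_def)
  then show ?thesis using vertex_decomposable_imp_well_covered by blast
qed

text \<open>For each deleted vertex there is a set of size 2 and one of size 3. With
  \<open>Z 1 j\<close>, one end of the path on four vertices is already dominated, and the midpoint
  of the other three dominates the rest. With \<open>W\<close>, the whole path has to be dominated
  from within, which takes two vertices.\<close>

lemma maximal_independent_set_L_graph_1:
  "maximal_independent_set (del_verts (L_graph 1) {X 1 1}) {Z 1 1, Y 1 3}"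
  "maximal_independent_set (del_verts (L_graph 1) {X 1 1}) {W, Y 1 1, Y 1 3}"
  "maximal_independent_set (del_verts (L_graph 1) {X 1 2}) {Z 1 3, Y 1 1}"
  "maximal_independent_set (del_verts (L_graph 1) {X 1 2}) {W, Y 1 1, Y 1 3}"
  "maximal_independent_set (del_verts (L_graph 1) {Y 1 1}) {Z 1 2, X 1 2}"
  "maximal_independent_set (del_verts (L_graph 1) {Y 1 1}) {W, Y 1 2, X 1 2}"
proof -
  note simps = maximal_independent_set_iff[OF finite_simple_graph_del_verts[OF
        finite_simple_graph_L_graph]] independent_set_def L_graph_adj verts_L_graph_1
  show
    "maximal_independent_set (del_verts (L_graph 1) {X 1 1}) {Z 1 1, Y 1 3}"
    "maximal_independent_set (del_verts (L_graph 1) {X 1 1}) {W, Y 1 1, Y 1 3}"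
    "maximal_independent_set (del_verts (L_graph 1) {X 1 2}) {Z 1 3, Y 1 1}"
    "maximal_independent_set (del_verts (L_graph 1) {X 1 2}) {W, Y 1 1, Y 1 3}"
    "maximal_independent_set (del_verts (L_graph 1) {Y 1 1}) {Z 1 2, X 1 2}"
    "maximal_independent_set (del_verts (L_graph 1) {Y 1 1}) {W, Y 1 2, X 1 2}"
    by (simp_all add: simps insert_Diff_if del: One_nat_def)
qed

theorem theorem6p13:
  fixes n :: nat
  assumes "n \<ge> 1"
  shows "vertex_decomposable (L_graph n) \<and> \<not> dominating_set (L_graph n) (Shed (L_graph n))"
proof
  show "vertex_decomposable (L_graph n)" by (rule vertex_decomposable_L_graph)
  \<comment> \<open>Sizes 2 and 3 differ, so \<open>X 1 1\<close> is not a shedding vertex; the same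
    comparison rules out its only two neighbours, \<open>X 1 2\<close> and \<open>Y 1 1\<close>.
    Hence \<open>X 1 1\<close> is left undominated.\<close>
  have "X 1 1 \<notin> Shed (L_graph n)"
    using not_vertex_decomposable_L_graph_del[OF assms _ maximal_independent_set_L_graph_1(1) _
        maximal_independent_set_L_graph_1(2)]
    by (simp add: Shed_def L_cycle_def cycle5_def)
  moreover have "X 1 2 \<notin> Shed (L_graph n)"
    using not_vertex_decomposable_L_graph_del[OF assms _ maximal_independent_set_L_graph_1(3) _
        maximal_independent_set_L_graph_1(4)]
    by (simp add: Shed_def L_cycle_def cycle5_def)
  moreover have "Y 1 1 \<notin> Shed (L_graph n)"
    using not_vertex_decomposable_L_graph_del[OF assms _ maximal_independent_set_L_graph_1(5) _
        maximal_independent_set_L_graph_1(6)]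
    by (simp add: Shed_def L_cycle_def cycle5_def)
  moreover have "X 1 1 \<in> verts (L_graph n)"
    using assms by (simp add: L_graph_def)
  moreover have "u = X 1 2 \<or> u = Y 1 1" if "{u, X 1 1} \<in> edges (L_graph n)" for u
    using that L_graph_adj_X1[of u 1 n] by blast
  ultimately show "\<not> dominating_set (L_graph n) (Shed (L_graph n))"
    unfolding dominating_set_def by (metis DiffI)
qed

end
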